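(* Let $F^A$ be an algebraic probability distribution function on $\mathbb{R}$ all of whose moments exist. Then the moment generating function $\mu_A(z)$ and the free cumulant generating function $r_A(g)$ of $F^A$ are algebraic power series. Moreover, both generating functions are D-finite and their coefficients are P-recursive.
   Context: The Stieltjes transform of a probability distribution function $F^A$ is $m_A(z)=\int\frac{1}{x-z}\,dF^A(x)$ for $z\in\mathbb{C}^+$ (the open upper half plane). $F^A$ is algebraic if there is a nonzero bivariate polynomial $L(m,z)$ with real coefficients such that $L(m_A(z),z)=0$ for all $z\in\mathbb{C}^+$. Moments: $M_j^A=\int x^j\,dF^A(x)$, with $M_0^A=1$; the moment generating function is the formal power series $\mu_A(z)=\sum_{j\ge 0}M_j^A z^j$. Free cumulants: let $g_A(z)=\sum_{j\ge0}M_j^A z^{-j-1}$ (formal series in $1/z$); the free cumulant generating function (R transform) is the formal power series $r_A(g)=\sum_{j\ge0}K_{j+1}^A g^j$ determined by $r_A(g)=g_A^{\langle -1\rangle}(g)-\frac1g$, i.e. $r_A(g_A(z))+\frac{1}{g_A(z)}=z$; the $K_j^A$ are the free cumulants. A formal power series $v\in\mathbb{R}[[u]]$ is algebraic if there are polynomials $P_0(u),\dots,P_d(u)$, not all identically zero, with $P_0(u)+P_1(u)v+\dots+P_d(u)v^d=0$. It is D-finite if there are polynomials $p_0(u),\dots,p_d(u)$ with $p_d\ne 0$ such that $p_d v^{(d)}+p_{d-1}v^{(d-1)}+\dots+p_1v^{(1)}+p_0v=0$, where $v^{(j)}=d^jv/du^j$. A sequence $(a_n)_{n\ge 0}$ is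 P-recursive if there are polynomials $P_0,\dots,P_e\in\mathbb{R}[n]$ with $P_e\ne 0$ such that $P_e(n)a_{n+e}+P_{e-1}(n)a_{n+e-1}+\dots+P_0(n)a_n=0$ for all $n\in\mathbb{N}$. *)

theory Defs
  imports
    "HOL-Probability.Probability"
    "HOL-Computational_Algebra.Computational_Algebra"
begin

definition prob_dist_fun :: "(real \<Rightarrow> real) \<Rightarrow> bool" where
  "prob_dist_fun F \<longleftrightarrow>
     mono F \<and> (\<forall>a. continuous (at_right a) F) \<and>
     (F \<longlongrightarrow> 0) at_bot \<and> (F \<longlongrightarrow> 1) at_top"

lemma real_distribution_prob_dist_fun:
  assumes "prob_dist_fun F"
  shows "real_distribution (interval_measure F)"
  using assms unfolding prob_dist_fun_def
  by (intro real_distribution_interval_measure) (auto dest: monoD)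

definition stieltjes_transform :: "(real \<Rightarrow> real) \<Rightarrow> complex \<Rightarrow> complex" where
  "stieltjes_transform F z = (LINT x|interval_measure F. 1 / (complex_of_real x - z))"

text \<open>A bivariate polynomial \<open>L(m,z)\<close> is a polynomial in \<open>m\<close> whose coefficients are
  polynomials in \<open>z\<close>.\<close>

definition eval_bipoly :: "real poly poly \<Rightarrow> complex \<Rightarrow> complex \<Rightarrow> complex" where
  "eval_bipoly L m z = poly (map_poly (\<lambda>p. poly (map_poly complex_of_real p) z) L) m"

definition algebraic_dist_fun :: "(real \<Rightarrow> real) \<Rightarrow> bool" where
  "algebraic_dist_fun F \<longleftrightarrow>
     (\<exists>L. L \<noteq> 0 \<and> (\<forall>z. Im z > 0 \<longrightarrow> eval_bipoly L (stieltjes_transform F z) z = 0))"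

definition all_moments_exist :: "(real \<Rightarrow> real) \<Rightarrow> bool" where
  "all_moments_exist F \<longleftrightarrow> (\<forall>j::nat. integrable (interval_measure F) (\<lambda>x. x ^ j))"

definition moment :: "(real \<Rightarrow> real) \<Rightarrow> nat \<Rightarrow> real" where
  "moment F j = (LINT x|interval_measure F. x ^ j)"

definition moment_gf :: "(real \<Rightarrow> real) \<Rightarrow> real fps" where
  "moment_gf F = Abs_fps (moment F)"

text \<open>The series \<open>g(z) = (\<Sum>j. M\<^sub>j z\<^sup>-\<^sup>j\<^sup>-\<^sup>1)\<close>, written as a power series in the
  variable \<open>w = 1/z\<close>.\<close>

definition cauchy_series :: "(real \<Rightarrow> real) \<Rightarrow> real fps" where
  "cauchy_series F = fps_X * moment_gf F"

text \<open>Since \<open>g\<close> is expanded in \<open>w = 1/z\<close>, its inverse in the variable \<open>z\<close> is the Laurent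
  series given by the reciprocal of the compositional inverse of \<^const>\<open>cauchy_series\<close>.
  Subtracting \<open>1/g\<close> leaves no principal part (\<open>fps_to_fls_free_cumulant_gf\<close> below), so
  taking the regular part is only a change of type.\<close>

definition free_cumulant_gf :: "(real \<Rightarrow> real) \<Rightarrow> real fps" where
  "free_cumulant_gf F =
     fls_regpart (inverse (fps_to_fls (fps_inv (cauchy_series F))) - fls_X_inv)"

text \<open>The free cumulant \<open>K\<^sub>j\<close> is meant for \<open>j \<ge> 1\<close>; the generating function starts at
  \<open>K\<^sub>1\<close>.\<close>

definition free_cumulant :: "(real \<Rightarrow> real) \<Rightarrow> nat \<Rightarrow> real" where
  "free_cumulant F j = fps_nth (free_cumulant_gf F) (j - 1)"

lemma cauchy_series_nth:
  assumes "prob_dist_fun F"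
  shows "fps_nth (cauchy_series F) 0 = 0" "fps_nth (cauchy_series F) 1 = 1"
proof -
  interpret real_distribution "interval_measure F"
    by (rule real_distribution_prob_dist_fun[OF assms])
  show "fps_nth (cauchy_series F) 0 = 0" "fps_nth (cauchy_series F) 1 = 1"
    using prob_space by (simp_all add: cauchy_series_def moment_gf_def moment_def)
qed

lemma fps_to_fls_free_cumulant_gf:
  assumes "prob_dist_fun F"
  shows "fps_to_fls (free_cumulant_gf F) =
           inverse (fps_to_fls (fps_inv (cauchy_series F))) - fls_X_inv"
proof -
  define H where "H = fps_inv (cauchy_series F)"
  define U where "U = fps_shift 1 H"
  have H0: "fps_nth H 0 = 0" and H1: "fps_nth H 1 = 1"
    using cauchy_series_nth[OF assms] by (simp_all add: H_def fps_inv_def)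
  have U0: "fps_nth U 0 = 1" using H1 by (simp add: U_def)
  have H: "H = fps_X * U"
    by (rule fps_ext) (auto simp: U_def H0)
  have "inverse (fps_to_fls H) = fls_X_inv * inverse (fps_to_fls U)"
    by (simp add: H fls_times_fps_to_fls fls_inverse_X)
  also have "inverse (fps_to_fls U) = fps_to_fls (inverse U)"
    using U0 by (simp add: fls_inverse_fps_to_fls subdegree_eq_0)
  finally have "inverse (fps_to_fls H) - fls_X_inv = fls_shift 1 (fps_to_fls (inverse U - 1))"
    by (intro fls_eqI) (simp add: fls_X_inv_times_conv_shift)
  also have "\<dots> = fps_to_fls (fps_shift 1 (inverse U - 1))"
    using U0 by (intro fls_eqI) (auto simp: nat_add_distrib)
  finally show ?thesis
    unfolding free_cumulant_gf_def H_def by simp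
qed

lemma free_cumulant_gf_iff:
  assumes "prob_dist_fun F"
  shows "fps_to_fls (r oo cauchy_series F) + inverse (fps_to_fls (cauchy_series F)) = fls_X_inv
           \<longleftrightarrow> r = free_cumulant_gf F"
proof -
  let ?G = "cauchy_series F"
  note G = cauchy_series_nth[OF assms]
  have G': "?G \<noteq> 0" using G(2) by auto
  have "fps_to_fls (free_cumulant_gf F oo ?G) =
          fls_compose_fps (fps_to_fls (free_cumulant_gf F)) ?G"
    using G G' by simp
  also have "\<dots> = inverse (fps_to_fls (fps_inv ?G oo ?G)) - inverse (fps_to_fls ?G)"
    unfolding fps_to_fls_free_cumulant_gf[OF assms] fls_inverse_X[symmetric]
    using G G' by (simp add: fls_compose_fps_diff fls_compose_fps_inverse del: fls_inverse_X)
  also have "fps_inv ?G oo ?G = fps_X"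
    using G by (intro fps_inv) auto
  finally have *: "fps_to_fls (free_cumulant_gf F oo ?G) + inverse (fps_to_fls ?G) = fls_X_inv"
    by (simp add: fls_inverse_X)
  have "fps_to_fls (r oo ?G) + inverse (fps_to_fls ?G) = fls_X_inv \<longleftrightarrow>
          fps_to_fls (r oo ?G) = fps_to_fls (free_cumulant_gf F oo ?G)"
    by (metis "*" add_right_cancel)
  also have "\<dots> \<longleftrightarrow> r = free_cumulant_gf F"
    using G by (simp add: fps_compose_inj_right)
  finally show ?thesis .
qed

definition algebraic_fps :: "real fps \<Rightarrow> bool" where
  "algebraic_fps v \<longleftrightarrow>
     (\<exists>(d::nat) P :: nat \<Rightarrow> real poly.
        (\<exists>i\<le>d. P i \<noteq> 0) \<and> (\<Sum>i\<le>d. fps_of_poly (P i) * v ^ i) = 0)"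

definition D_finite :: "real fps \<Rightarrow> bool" where
  "D_finite v \<longleftrightarrow>
     (\<exists>(d::nat) p :: nat \<Rightarrow> real poly.
        p d \<noteq> 0 \<and> (\<Sum>i\<le>d. fps_of_poly (p i) * (fps_deriv ^^ i) v) = 0)"

definition P_recursive :: "(nat \<Rightarrow> real) \<Rightarrow> bool" where
  "P_recursive a \<longleftrightarrow>
     (\<exists>(e::nat) P :: nat \<Rightarrow> real poly.
        P e \<noteq> 0 \<and> (\<forall>n. (\<Sum>i\<le>e. poly (P i) (real n) * a (n + i)) = 0))"

end

theory Submission
  imports Defs
begin

text \<open>
  Expanding \<open>1 / (x - z)\<close> as a geometric series shows that \<open>m(1/w)\<close> has the asymptotic
  expansion \<open>- w \<mu>(w)\<close> as \<open>w \<rightarrow> 0\<close> along the negative imaginary axis. Asymptotic expansions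
  are unique and compatible with sums and products, so \<open>L(m(z), z) = 0\<close>, after clearing the
  negative powers of \<open>w\<close>, becomes a polynomial equation for the formal series \<open>- w \<mu>(w)\<close>.
  Exchanging the roles of the two variables in it gives an equation for the compositional inverse
  \<open>h\<close> of \<open>w \<mu>(w)\<close>, hence for \<open>V = w / h = 1 + w r(w)\<close>, hence for \<open>r\<close>.

  If \<open>v\<close> is a root of \<open>P\<close> of minimal degree \<open>d\<close> and \<open>W = P'(v)\<close>, then each
  \<open>W^(2i) v^(i)\<close>, where \<open>v^(i)\<close> is the \<open>i\<close>-th derivative, is a polynomial in \<open>v\<close> over \<open>\<real>[u]\<close>.
  Reduced modulo \<open>P\<close>, the \<open>d + 1\<close> elements \<open>W^(2d) v^(i)\<close>, \<open>i \<le> d\<close>, are linearly dependent, and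
  cancelling \<open>W^(2d)\<close> leaves a differential equation. Comparing coefficients in it gives the
  recurrence.
\<close>

subsection \<open>Evaluating polynomials at a power series\<close>

text \<open>The outer variable is the unknown; the coefficients are polynomials in the series
  variable. Packing an algebraic equation into one such object makes degree, composition and
  pseudo-division available.\<close>

definition poly_at_fps :: "'a::idom poly poly \<Rightarrow> 'a fps \<Rightarrow> 'a fps" where
  "poly_at_fps p v = poly (map_poly fps_of_poly p) v"

lemma poly_at_fps_0 [simp]: "poly_at_fps 0 v = 0"
  by (simp add: poly_at_fps_def)

lemma poly_at_fps_pCons: "poly_at_fps (pCons a p) v = fps_of_poly a + v * poly_at_fps p v"
  by (simp add: poly_at_fps_def map_poly_pCons)

lemma poly_at_fps_add: "poly_at_fps (p + q) v = poly_at_fps p v + poly_at_fps q v"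
  by (induction p q rule: poly_induct2)
    (simp_all add: poly_at_fps_pCons fps_of_poly_add algebra_simps)

lemma poly_at_fps_smult: "poly_at_fps (smult c p) v = fps_of_poly c * poly_at_fps p v"
  by (induction p) (simp_all add: poly_at_fps_pCons fps_of_poly_mult algebra_simps)

lemma poly_at_fps_uminus: "poly_at_fps (- p) v = - poly_at_fps p v"
  using poly_at_fps_smult[of "-1" p v] by (simp add: fps_of_poly_uminus)

lemma poly_at_fps_diff: "poly_at_fps (p - q) v = poly_at_fps p v - poly_at_fps q v"
  using poly_at_fps_add[of p "- q" v] by (simp add: poly_at_fps_uminus)

lemma poly_at_fps_mult: "poly_at_fps (p * q) v = poly_at_fps p v * poly_at_fps q v"
  by (induction p)
    (simp_all add: poly_at_fps_pCons poly_at_fps_add poly_at_fps_smult algebra_simps)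

lemma poly_at_fps_1 [simp]: "poly_at_fps 1 v = 1"
  by (simp add: one_pCons poly_at_fps_pCons)

lemma poly_at_fps_power: "poly_at_fps (p ^ n) v = poly_at_fps p v ^ n"
  by (induction n) (simp_all add: poly_at_fps_mult)

lemma poly_at_fps_pcompose: "poly_at_fps (pcompose p q) v = poly_at_fps p (poly_at_fps q v)"
  by (induction p)
    (simp_all add: pcompose_pCons poly_at_fps_pCons poly_at_fps_add poly_at_fps_mult)

lemma poly_at_fps_altdef:
  assumes "degree p \<le> n"
  shows "poly_at_fps p v = (\<Sum>i\<le>n. fps_of_poly (coeff p i) * v ^ i)"
proof -
  have "poly_at_fps p v = (\<Sum>i\<le>degree p. fps_of_poly (coeff p i) * v ^ i)"
    by (simp add: poly_at_fps_def poly_altdef degree_map_poly coeff_map_poly)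
  also have "\<dots> = (\<Sum>i\<le>n. fps_of_poly (coeff p i) * v ^ i)"
    using assms by (intro sum.mono_neutral_left) (auto intro!: coeff_eq_0)
  finally show ?thesis .
qed

lemma algebraic_fps_iff: "algebraic_fps v \<longleftrightarrow> (\<exists>p. p \<noteq> 0 \<and> poly_at_fps p v = 0)"
proof
  assume "algebraic_fps v"
  then obtain d P i where P: "i \<le> d" "P i \<noteq> 0" "(\<Sum>i\<le>d. fps_of_poly (P i) * v ^ i) = 0"
    unfolding algebraic_fps_def by blast
  define p where "p = (\<Sum>i\<le>d. monom (P i) i)"
  have co: "coeff p k = (if k \<le> d then P k else 0)" for k
    by (simp add: p_def coeff_sum)
  hence "degree p \<le> d"
    by (intro degree_le) auto
  hence "poly_at_fps p v = 0"
    using P(3) by (simp add: poly_at_fps_altdef co)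
  moreover have "p \<noteq> 0"
    using P(1,2) co[of i] by auto
  ultimately show "\<exists>p. p \<noteq> 0 \<and> poly_at_fps p v = 0"
    by blast
next
  assume "\<exists>p. p \<noteq> 0 \<and> poly_at_fps p v = 0"
  then obtain p where p: "p \<noteq> 0" "poly_at_fps p v = 0"
    by blast
  have "\<exists>i\<le>degree p. coeff p i \<noteq> 0"
    using p(1) leading_coeff_neq_0 by blast
  thus "algebraic_fps v"
    unfolding algebraic_fps_def using p(2) poly_at_fps_altdef[of p "degree p" v] by auto
qed

text \<open>Compose an annihilating polynomial with \<open>[:a, b:]\<close>. The inner polynomial
  has degree 1 because \<open>b\<close> is nonzero, so the composition does not vanish.\<close>

lemma algebraic_fps_affineD:
  assumes "algebraic_fps (fps_of_poly a + fps_of_poly b * v)" "b \<noteq> 0"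
  shows "algebraic_fps v"
proof -
  obtain p where p: "p \<noteq> 0" "poly_at_fps p (fps_of_poly a + fps_of_poly b * v) = 0"
    using assms(1) algebraic_fps_iff by blast
  have "poly_at_fps (pcompose p [:a, b:]) v = 0"
    using p(2) by (simp add: poly_at_fps_pcompose poly_at_fps_pCons mult.commute)
  moreover have "pcompose p [:a, b:] \<noteq> 0"
    using p(1) assms(2) by (simp add: pcompose_eq_0_iff)
  ultimately show ?thesis
    using algebraic_fps_iff by blast
qed

subsection \<open>Algebraic series are D-finite\<close>

text \<open>Chain rule: the summands come from the partial derivatives in the series variable
  (coefficientwise) and in the unknown.\<close>

lemma fps_deriv_poly_at_fps:
  "fps_deriv (poly_at_fps p v) =
     poly_at_fps (map_poly pderiv p) v + poly_at_fps (pderiv p) v * fps_deriv v"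
proof (induction p)
  case (pCons a p)
  then show ?case
    by (simp add: poly_at_fps_pCons map_poly_pCons pderiv_pCons poly_at_fps_add
        fps_of_poly_pderiv algebra_simps)
qed simp

text \<open>Fraction-free Gaussian elimination.\<close>

lemma nontrivial_linear_relation:
  fixes A :: "'i \<Rightarrow> nat \<Rightarrow> 'a::idom"
  assumes "finite I" "n < card I"
  shows "\<exists>c. (\<exists>i\<in>I. c i \<noteq> 0) \<and> (\<forall>j<n. (\<Sum>i\<in>I. c i * A i j) = 0)"
  using assms
proof (induction n arbitrary: I A)
  case 0
  then obtain i where "i \<in> I"
    by fastforce
  then show ?case
    by (intro exI[of _ "\<lambda>_. 1"]) auto
next
  case (Suc n)
  show ?case
  proof (cases "\<forall>i\<in>I. A i n = 0")
    case True
    obtain c where c: "\<exists>i\<in>I. c i \<noteq> 0" "\<forall>j<n. (\<Sum>i\<in>I. c i * A i j) = 0"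
      using Suc.IH[of I A] Suc.prems by auto
    show ?thesis
      using c True by (intro exI[of _ c]) (auto simp: less_Suc_eq)
  next
    case False
    then obtain p where p: "p \<in> I" "A p n \<noteq> 0"
      by blast
    let ?J = "I - {p}"
    define B where "B i j = A p n * A i j - A i n * A p j" for i j
    have "n < card ?J"
      using Suc.prems p(1) by simp
    then obtain c where c: "\<exists>i\<in>?J. c i \<noteq> 0" "\<forall>j<n. (\<Sum>i\<in>?J. c i * B i j) = 0"
      using Suc.IH[of ?J B] Suc.prems by auto
    \<comment> \<open>The weight at \<open>p\<close> collects the multiples of the pivot row
      subtracted in \<open>B\<close>, so both sums agree in every column. Scaling by the pivot keeps
      nonzero weights nonzero in an integral domain.\<close>
    define c' where "c' i = (if i = p then - (\<Sum>i\<in>?J. c i * A i n) else c i * A p n)" for i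
    have "(\<Sum>i\<in>I. c' i * A i j) = (\<Sum>i\<in>?J. c i * B i j)" for j
    proof -
      have "(\<Sum>i\<in>I. c' i * A i j) = c' p * A p j + (\<Sum>i\<in>?J. c' i * A i j)"
        using Suc.prems p(1) by (simp add: sum.remove)
      also have "(\<Sum>i\<in>?J. c' i * A i j) = (\<Sum>i\<in>?J. c i * A p n * A i j)"
        by (intro sum.cong) (auto simp: c'_def)
      also have "c' p * A p j + \<dots> = (\<Sum>i\<in>?J. c i * B i j)"
        by (simp add: c'_def B_def sum_distrib_left sum_subtractf algebra_simps)
      finally show ?thesis .
    qed
    moreover have "(\<Sum>i\<in>?J. c i * B i n) = 0"
      by (intro sum.neutral) (auto simp: B_def)
    moreover have "\<exists>i\<in>I. c' i \<noteq> 0"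
      using c(1) p(2) by (auto simp: c'_def)
    ultimately show ?thesis
      using c(2) by (intro exI[of _ c']) (auto simp: less_Suc_eq)
  qed
qed

lemma last_nonzero_index:
  fixes c :: "nat \<Rightarrow> 'a::zero"
  assumes "k \<le> n" "c k \<noteq> 0"
  obtains d where "d \<le> n" "c d \<noteq> 0" "\<And>i. d < i \<Longrightarrow> i \<le> n \<Longrightarrow> c i = 0"
proof -
  let ?P = "\<lambda>i. i \<le> n \<and> c i \<noteq> 0"
  have "?P (Greatest ?P)"
    using assms by (intro GreatestI_nat[of ?P k n]) auto
  moreover have "i \<le> Greatest ?P" if "?P i" for i
    using that by (intro Greatest_le_nat[of ?P i n]) auto
  ultimately show thesis
    using that by (meson not_le)
qed

lemma D_finiteI:
  assumes "(\<Sum>i\<le>n. fps_of_poly (c i) * (fps_deriv ^^ i) v) = 0" "k \<le> n" "c k \<noteq> 0"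
  shows "D_finite v"
proof -
  obtain d where "d \<le> n" "c d \<noteq> 0" "\<And>i. d < i \<Longrightarrow> i \<le> n \<Longrightarrow> c i = 0"
    using last_nonzero_index assms(2,3) by blast
  moreover from this have "(\<Sum>i\<le>d. fps_of_poly (c i) * (fps_deriv ^^ i) v) =
     (\<Sum>i\<le>n. fps_of_poly (c i) * (fps_deriv ^^ i) v)"
    by (intro sum.mono_neutral_left) auto
  ultimately show ?thesis
    unfolding D_finite_def using assms(1) by auto
qed

theorem algebraic_fps_imp_D_finite:
  assumes "algebraic_fps v"
  shows "D_finite v"
proof -
  let ?root = "\<lambda>p. p \<noteq> 0 \<and> poly_at_fps p v = 0"
  obtain p0 where "?root p0"
    using assms algebraic_fps_iff by blast
  then obtain p where p: "p \<noteq> 0" "poly_at_fps p v = 0"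
    and p_min: "\<And>q. q \<noteq> 0 \<Longrightarrow> poly_at_fps q v = 0 \<Longrightarrow> degree p \<le> degree q"
    using arg_min_nat_lemma[of ?root p0 degree] by blast
  have deg_p: "degree p > 0"
  proof (rule ccontr)
    assume "\<not> degree p > 0"
    then obtain a where "p = [:a:]"
      using degree_eq_zeroE by blast
    thus False
      using p fps_of_poly_eq_iff[of a 0] by (simp add: poly_at_fps_pCons)
  qed
  define W where "W = poly_at_fps (pderiv p) v"
  \<comment> \<open>In characteristic 0 the derivative of the nonconstant \<open>p\<close> is
    nonzero of smaller degree, so by minimality \<open>v\<close> is not a root of it.\<close>
  have "W \<noteq> 0"
    using p_min[of "pderiv p"] deg_p by (auto simp: W_def pderiv_eq_0_iff degree_pderiv)
  define R where "R = range (\<lambda>q. poly_at_fps q v)"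
  have R_mult: "f * g \<in> R" and R_diff: "f - g \<in> R" if "f \<in> R" "g \<in> R" for f g
    using that unfolding R_def image_iff
    by (metis poly_at_fps_mult poly_at_fps_diff UNIV_I)+
  have R_of_nat: "of_nat n \<in> R" for n
    unfolding R_def by (intro image_eqI[of _ _ "[:of_nat n:]"])
      (auto simp: poly_at_fps_pCons of_nat_poly fps_of_poly_const fps_of_nat)
  have W_R: "W \<in> R"
    by (simp add: W_def R_def)
  have W_pow_R: "W ^ n \<in> R" for n
    by (simp add: W_def R_def flip: poly_at_fps_power)
  \<comment> \<open>The ring \<open>R\<close> need not be closed under derivation, but
    differentiating \<open>p(v) = 0\<close> puts \<open>W * fps_deriv v\<close> into
    \<open>R\<close>, so one factor \<open>W\<close> suffices for every element.\<close>
  have R_deriv: "W * fps_deriv f \<in> R" if f: "f \<in> R" for f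
  proof -
    obtain q where q: "f = poly_at_fps q v"
      using f unfolding R_def by blast
    have "poly_at_fps (map_poly pderiv p) v + W * fps_deriv v = 0"
      using fps_deriv_poly_at_fps[of p v] p(2) by (simp add: W_def)
    hence *: "W * fps_deriv v = - poly_at_fps (map_poly pderiv p) v"
      by (simp add: eq_neg_iff_add_eq_0 add.commute)
    have "W * fps_deriv f = W * poly_at_fps (map_poly pderiv q) v
        + poly_at_fps (pderiv q) v * (W * fps_deriv v)"
      by (simp add: q fps_deriv_poly_at_fps algebra_simps)
    also have "\<dots> = W * poly_at_fps (map_poly pderiv q) v
        - poly_at_fps (pderiv q) v * poly_at_fps (map_poly pderiv p) v"
      by (simp add: *)
    also have "\<dots> \<in> R"
      by (intro R_diff R_mult W_R) (auto simp: R_def)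
    finally show ?thesis .
  qed
  \<comment> \<open>Besides the factor spent on the derivative of \<open>W ^ k * f\<close>, the
    correction term of the product rule contains the derivative of \<open>W\<close>, which needs a
    factor of its own. Hence the exponent grows by two.\<close>
  have pow_deriv: "W ^ (k + 2) * fps_deriv f \<in> R" if "W ^ k * f \<in> R" for k f
  proof -
    have *: "W ^ (k + 2) * fps_deriv f =
        W * (W * fps_deriv (W ^ k * f)) - of_nat k * (W ^ k * f) * (W * fps_deriv W)"
    proof -
      have "W * fps_deriv (W ^ k) = of_nat k * W ^ k * fps_deriv W"
        unfolding fps_deriv_power' by (cases k) (simp_all add: mult_ac)
      thus ?thesis
        by (simp add: algebra_simps)
    qed
    show ?thesis
      unfolding * by (intro R_diff R_mult[OF W_R R_deriv]
          R_mult[OF R_mult[OF R_of_nat] R_deriv] W_R that)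
  qed
  have derivs: "W ^ (2 * i) * (fps_deriv ^^ i) v \<in> R" for i
  proof (induction i)
    case 0
    have "poly_at_fps [:0, 1:] v = v"
      by (simp add: poly_at_fps_pCons flip: one_pCons)
    hence "v \<in> R"
      unfolding R_def by (metis rangeI)
    thus ?case by simp
  next
    case (Suc i)
    thus ?case using pow_deriv[of "2 * i"] by simp
  qed
  define d where "d = degree p"
  have reduce: "\<exists>s r. s \<noteq> 0 \<and> degree r < d \<and>
      fps_of_poly s * (W ^ (2 * d) * (fps_deriv ^^ i) v) = poly_at_fps r v" if "i \<le> d" for i
  proof -
    have "2 * d = 2 * (d - i) + 2 * i"
      using that by simp
    hence "W ^ (2 * d) * (fps_deriv ^^ i) v = W ^ (2 * (d - i)) * (W ^ (2 * i) * (fps_deriv ^^ i) v)"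
      by (metis power_add mult.assoc)
    also have "\<dots> \<in> R"
      by (intro R_mult W_pow_R derivs)
    finally obtain f where f: "W ^ (2 * d) * (fps_deriv ^^ i) v = poly_at_fps f v"
      unfolding R_def by blast
    \<comment> \<open>Pseudo-division avoids inverting the leading coefficient of \<open>p\<close>,
      at the cost of the nonzero factor \<open>a\<close>; the multiple of \<open>p\<close> vanishes
      at \<open>v\<close>.\<close>
    obtain a q where aq: "a \<noteq> 0" "smult a f = p * q + pseudo_mod f p"
      using pseudo_mod(1)[OF p(1), of f] by blast
    have "fps_of_poly a * poly_at_fps f v = poly_at_fps (pseudo_mod f p) v"
      using arg_cong[OF aq(2), of "\<lambda>q. poly_at_fps q v"] p(2)
      by (simp add: poly_at_fps_smult poly_at_fps_add poly_at_fps_mult)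
    moreover have "degree (pseudo_mod f p) < d"
      using pseudo_mod(2)[OF p(1), of f] deg_p by (auto simp: d_def)
    ultimately show ?thesis
      using aq(1) f by auto
  qed
  then obtain s r where sr: "s i \<noteq> 0" "degree (r i) < d"
      "fps_of_poly (s i) * (W ^ (2 * d) * (fps_deriv ^^ i) v) = poly_at_fps (r i) v"
    if "i \<le> d" for i
    by metis
  \<comment> \<open>There are \<open>d + 1\<close> remainders with only \<open>d\<close>
    coefficients each.\<close>
  obtain c where c: "\<exists>i\<in>{..d}. c i \<noteq> 0" "\<forall>j<d. (\<Sum>i\<le>d. c i * coeff (r i) j) = 0"
    using nontrivial_linear_relation[of "{..d}" d "\<lambda>i. coeff (r i)"] by auto
  have r: "poly_at_fps (r i) v = (\<Sum>j<d. fps_of_poly (coeff (r i) j) * v ^ j)" if "i \<le> d" for i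
    using poly_at_fps_altdef[of "r i" "d - 1" v] sr(2)[OF that] lessThan_Suc_atMost[of "d - 1"]
    by fastforce
  have "W ^ (2 * d) * (\<Sum>i\<le>d. fps_of_poly (c i * s i) * (fps_deriv ^^ i) v) =
      (\<Sum>i\<le>d. fps_of_poly (c i) * poly_at_fps (r i) v)"
    unfolding sum_distrib_left
    by (intro sum.cong) (auto simp: fps_of_poly_mult algebra_simps simp flip: sr(3))
  also have "\<dots> = (\<Sum>i\<le>d. \<Sum>j<d. fps_of_poly (c i * coeff (r i) j) * v ^ j)"
    by (simp add: r sum_distrib_left fps_of_poly_mult mult.assoc)
  also have "\<dots> = (\<Sum>j<d. fps_of_poly (\<Sum>i\<le>d. c i * coeff (r i) j) * v ^ j)"
    by (subst sum.swap) (simp add: fps_of_poly_sum sum_distrib_right)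
  also have "\<dots> = 0"
    using c(2) by simp
  finally have "(\<Sum>i\<le>d. fps_of_poly (c i * s i) * (fps_deriv ^^ i) v) = 0"
    using \<open>W \<noteq> 0\<close> by simp
  moreover obtain k where "k \<le> d" "c k * s k \<noteq> 0"
    using c(1) sr(1) by auto
  ultimately show ?thesis
    by (intro D_finiteI)
qed

subsection \<open>D-finite series have P-recursive coefficients\<close>

lemma fps_nth_deriv_funpow:
  "((fps_deriv ^^ i) v) $ n = pochhammer (of_nat (Suc n)) i * v $ (n + i)"
proof (induction i arbitrary: n)
  case (Suc i)
  then show ?case
    by (simp add: pochhammer_rec algebra_simps)
qed simp

text \<open>The rising factorial is taken in the polynomial ring, giving the factor from the
  \<open>i\<close>-th derivative as a polynomial in \<open>n\<close>. Its exact degree later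
  separates the orders of differentiation.\<close>

lemma degree_pochhammer_linear:
  "degree (pochhammer [:b, 1 :: 'a::idom:] i) = i \<and> pochhammer [:b, 1 :: 'a:] i \<noteq> 0"
proof (induction i arbitrary: b)
  case (Suc i)
  have *: "[:b, 1:] + 1 = [:b + 1, 1 :: 'a:]"
    by (simp add: one_pCons)
  show ?case
    using Suc.IH[of "b + 1"] degree_mult_eq[of "[:b, 1:]" "pochhammer [:b + 1, 1:] i"]
    unfolding pochhammer_rec * by (auto simp del: mult_pCons_left)
qed simp

lemma poly_pochhammer_linear:
  "poly (pochhammer [:b, 1:] i) (x :: 'a::comm_ring_1) = pochhammer (b + x) i"
  by (induction i) (simp_all add: pochhammer_Suc poly_of_nat algebra_simps)

theorem D_finite_imp_P_recursive:
  assumes "D_finite v"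
  shows "P_recursive (fps_nth v)"
proof -
  obtain d p where p: "p d \<noteq> 0" "(\<Sum>i\<le>d. fps_of_poly (p i) * (fps_deriv ^^ i) v) = 0"
    using assms unfolding D_finite_def by blast
  define J where "J = Max ((degree \<circ> p) ` {..d})"
  have J: "degree (p i) \<le> J" if "i \<le> d" for i
    unfolding J_def using that by (intro Max_ge) auto
  \<comment> \<open>Coefficient \<open>j\<close> of \<open>p i\<close> meets coefficient
    \<open>n + J - j\<close> of the \<open>i\<close>-th derivative, a multiple of
    \<open>v $ (n + l)\<close> for \<open>l = J - j + i\<close>. The rising factorial there starts
    at \<open>n + (l - i) + 1\<close>.\<close>
  define q where "q i l = (if l \<le> J + i \<and> i \<le> l then
      smult (coeff (p i) (J + i - l)) (pochhammer [:of_nat (l - i + 1), 1:] i) else 0)" for i l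
  define P where "P l = (\<Sum>i\<le>d. q i l)" for l
  have rec: "(\<Sum>l\<le>J + d. poly (P l) (real n) * v $ (n + l)) = 0" for n
  proof -
    \<comment> \<open>At index \<open>n + J\<close> no \<open>j\<close> up to \<open>J\<close> is
      cut off from the convolution, so one formula serves all \<open>n\<close>.\<close>
    have "0 = (\<Sum>i\<le>d. fps_of_poly (p i) * (fps_deriv ^^ i) v) $ (n + J)"
      using p(2) by simp
    also have "\<dots> = (\<Sum>i\<le>d. \<Sum>l\<le>J + d. poly (q i l) (real n) * v $ (n + l))"
      unfolding fps_sum_nth
    proof (rule sum.cong[OF refl])
      fix i assume i: "i \<in> {..d}"
      have "(fps_of_poly (p i) * (fps_deriv ^^ i) v) $ (n + J) =
          (\<Sum>j\<le>n + J. coeff (p i) j * (fps_deriv ^^ i) v $ (n + J - j))"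
        by (simp add: fps_mult_nth atMost_atLeast0)
      also have "\<dots> = (\<Sum>j\<le>J. coeff (p i) j * (fps_deriv ^^ i) v $ (n + J - j))"
        using J[of i] i by (intro sum.mono_neutral_right) (auto intro!: coeff_eq_0)
      also have "\<dots> = (\<Sum>l\<in>{i..J + i}. poly (q i l) (real n) * v $ (n + l))"
      proof (rule sum.reindex_bij_witness[of _ "\<lambda>l. J + i - l" "\<lambda>j. J - j + i"])
        fix j assume "j \<in> {..J}"
        thus "poly (q i (J - j + i)) (real n) * v $ (n + (J - j + i)) =
            coeff (p i) j * (fps_deriv ^^ i) v $ (n + J - j)"
          by (simp add: q_def fps_nth_deriv_funpow poly_pochhammer_linear of_nat_diff algebra_simps)
      qed auto
      also have "\<dots> = (\<Sum>l\<le>J + d. poly (q i l) (real n) * v $ (n + l))"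
        using i by (intro sum.mono_neutral_left) (auto simp: q_def)
      finally show "(fps_of_poly (p i) * (fps_deriv ^^ i) v) $ (n + J) =
          (\<Sum>l\<le>J + d. poly (q i l) (real n) * v $ (n + l))" .
    qed
    also have "\<dots> = (\<Sum>l\<le>J + d. poly (P l) (real n) * v $ (n + l))"
      by (subst sum.swap) (simp add: P_def poly_sum sum_distrib_right)
    finally show ?thesis by simp
  qed
  \<comment> \<open>In \<open>P l\<close> the summand from the \<open>i\<close>-th derivative is \<open>0\<close> or has degree exactly \<open>i\<close>, so
    the leading term of \<open>p d\<close> cannot cancel.\<close>
  define l where "l = J + d - degree (p d)"
  have l: "d \<le> l" "l \<le> J + d" "J + d - l = degree (p d)"
    using J[of d] by (auto simp: l_def)
  have "coeff (P l) d \<noteq> 0"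
  proof -
    have "coeff (q i l) d = 0" if "i < d" for i
      using that degree_pochhammer_linear[of "of_nat (l - i + 1) :: real" i]
      by (auto simp: q_def intro!: coeff_eq_0)
    hence "coeff (P l) d = coeff (q d l) d"
      by (simp add: P_def coeff_sum atMost_Suc lessThan_Suc_atMost[symmetric])
    also have "\<dots> \<noteq> 0"
      using l p(1) degree_pochhammer_linear[of "of_nat (l - d + 1) :: real" d]
      by (auto simp: q_def dest: leading_coeff_neq_0)
    finally show ?thesis .
  qed
  hence "P l \<noteq> 0" by auto
  \<comment> \<open>\<open>P (J + d)\<close> may vanish, so the recurrence is cut after its last
    nonzero coefficient.\<close>
  then obtain e where e: "e \<le> J + d" "P e \<noteq> 0" "\<And>i. e < i \<Longrightarrow> i \<le> J + d \<Longrightarrow> P i = 0"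
    using last_nonzero_index l(2) by blast
  have "(\<Sum>l\<le>e. poly (P l) (real n) * v $ (n + l)) = 0" for n
  proof -
    have "(\<Sum>l\<le>e. poly (P l) (real n) * v $ (n + l)) =
        (\<Sum>l\<le>J + d. poly (P l) (real n) * v $ (n + l))"
      using e(1,3) by (intro sum.mono_neutral_left) auto
    thus ?thesis
      using rec by simp
  qed
  thus ?thesis
    unfolding P_recursive_def using e(2) by blast
qed

subsection \<open>Algebraicity of compositional inverses\<close>

text \<open>Substituting the inverse \<open>H\<close> into the equation of \<open>G\<close> turns
  \<open>G\<close> into the variable \<open>X\<close> and \<open>P i\<close> into
  \<open>P i (H)\<close>. Since \<open>H = X / V\<close>, multiplying by a high power of
  \<open>V\<close> leaves a polynomial equation for \<open>V\<close>.\<close>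

lemma algebraic_fps_inv_quotient:
  fixes G V :: "real fps"
  assumes "algebraic_fps G" "G $ 0 = 0" "G $ 1 \<noteq> 0" "fps_inv G * V = fps_X"
  shows "algebraic_fps V"
proof -
  define H where "H = fps_inv G"
  have H0: "H $ 0 = 0"
    by (simp add: H_def fps_inv_def)
  have GH: "G oo H = fps_X"
    unfolding H_def using assms(2,3) by (rule fps_inv_right)
  have HV: "H * V = fps_X"
    using assms(4) by (simp add: H_def)
  obtain d P i0 where P: "i0 \<le> d" "P i0 \<noteq> 0" "(\<Sum>i\<le>d. fps_of_poly (P i) * G ^ i) = 0"
    using assms(1) unfolding algebraic_fps_def by blast
  define D where "D = Max ((degree \<circ> P) ` {..d})"
  have D: "degree (P i) \<le> D" if "i \<le> d" for i
    unfolding D_def using that by (intro Max_ge) auto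
  have *: "V ^ D * (fps_of_poly p oo H) = (\<Sum>j\<le>D. fps_const (coeff p j) * fps_X ^ j * V ^ (D - j))"
    if "degree p \<le> D" for p
  proof -
    have "fps_of_poly p = (\<Sum>j\<le>D. fps_const (coeff p j) * fps_X ^ j)"
      using that by (intro fps_ext)
        (auto simp: fps_sum_nth fps_X_power_nth if_distrib[of "\<lambda>x. _ * x"] cong: if_cong
          intro!: coeff_eq_0)
    hence "V ^ D * (fps_of_poly p oo H) = (\<Sum>j\<le>D. fps_const (coeff p j) * (V ^ D * H ^ j))"
      by (simp add: fps_compose_sum_distrib fps_compose_mult_distrib H0 sum_distrib_left
          mult.left_commute flip: fps_compose_power)
    also have "\<dots> = (\<Sum>j\<le>D. fps_const (coeff p j) * fps_X ^ j * V ^ (D - j))"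
    proof (intro sum.cong refl)
      fix j assume "j \<in> {..D}"
      hence "V ^ D = V ^ j * V ^ (D - j)"
        by (simp flip: power_add)
      hence "V ^ D * H ^ j = (H * V) ^ j * V ^ (D - j)"
        by (simp add: power_mult_distrib)
      thus "fps_const (coeff p j) * (V ^ D * H ^ j) =
          fps_const (coeff p j) * fps_X ^ j * V ^ (D - j)"
        by (simp add: HV mult.assoc)
    qed
    finally show ?thesis .
  qed
  \<comment> \<open>Collects the terms with \<open>V ^ k\<close>, that is, those with
    \<open>j = D - k\<close>.\<close>
  define Q where "Q k = (\<Sum>i\<le>d. monom (coeff (P i) (D - k)) (i + (D - k)))" for k
  have Q: "fps_of_poly (Q k) = (\<Sum>i\<le>d. fps_const (coeff (P i) (D - k)) * fps_X ^ (i + (D - k)))" for k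
    by (simp add: Q_def fps_of_poly_sum fps_of_poly_monom)
  have "0 = V ^ D * ((\<Sum>i\<le>d. fps_of_poly (P i) * G ^ i) oo H)"
    by (simp add: P(3))
  also have "\<dots> = (\<Sum>i\<le>d. V ^ D * (fps_of_poly (P i) oo H) * fps_X ^ i)"
    by (simp add: fps_compose_sum_distrib fps_compose_mult_distrib H0 GH sum_distrib_left mult.assoc
        flip: fps_compose_power)
  also have "\<dots> = (\<Sum>i\<le>d. \<Sum>j\<le>D. fps_const (coeff (P i) j) * fps_X ^ (i + j) * V ^ (D - j))"
    by (intro sum.cong) (simp_all add: * D sum_distrib_right sum_distrib_left power_add algebra_simps)
  also have "\<dots> = (\<Sum>j\<le>D. \<Sum>i\<le>d. fps_const (coeff (P i) j) * fps_X ^ (i + j) * V ^ (D - j))"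
    by (rule sum.swap)
  also have "\<dots> = (\<Sum>k\<le>D. fps_of_poly (Q k) * V ^ k)"
    by (rule sum.reindex_bij_witness[of _ "\<lambda>k. D - k" "\<lambda>j. D - j"])
      (auto simp: Q sum_distrib_right)
  finally have "(\<Sum>k\<le>D. fps_of_poly (Q k) * V ^ k) = 0"
    by simp
  \<comment> \<open>For fixed \<open>k\<close> the monomials of \<open>Q k\<close> have different
    exponents for different \<open>i\<close>, so none cancel and the leading coefficient of
    \<open>P i0\<close> survives.\<close>
  moreover have "coeff (Q (D - degree (P i0))) (i0 + degree (P i0)) = lead_coeff (P i0)"
    using D[OF P(1)] P(1) by (simp add: Q_def coeff_sum)
  hence "Q (D - degree (P i0)) \<noteq> 0"
    using P(2) by (metis coeff_0 leading_coeff_0_iff)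
  ultimately show ?thesis
    unfolding algebraic_fps_def
    by (intro exI[of _ D] exI[of _ Q] conjI exI[of _ "D - degree (P i0)"]) simp_all
qed

text \<open>As Laurent series, \<open>r = 1/H - 1/X\<close> for the inverse \<open>H\<close> of the
  Cauchy series, so \<open>1 + X r\<close> is the quotient \<open>X / H\<close>.\<close>

lemma algebraic_free_cumulant_gf:
  assumes "prob_dist_fun F" "algebraic_fps (cauchy_series F)"
  shows "algebraic_fps (free_cumulant_gf F)"
proof -
  let ?H = "fps_inv (cauchy_series F)" and ?r = "free_cumulant_gf F"
  note G = cauchy_series_nth[OF assms(1)]
  have "?H $ 1 \<noteq> 0"
    using G by (simp add: fps_inv_def)
  hence "?H \<noteq> 0" by auto
  have "fps_to_fls (?H * (1 + fps_X * ?r)) =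
      fps_to_fls ?H * (1 + fls_X * (inverse (fps_to_fls ?H) - fls_X_inv))"
    by (simp add: fls_times_fps_to_fls fps_to_fls_free_cumulant_gf[OF assms(1)])
  also have "fls_X * (inverse (fps_to_fls ?H) - fls_X_inv) = fls_X * inverse (fps_to_fls ?H) - 1"
    by (simp add: right_diff_distrib del: fls_inverse_X flip: fls_inverse_X)
  also have "fps_to_fls ?H * (1 + \<dots>) = fps_to_fls fps_X"
    using \<open>?H \<noteq> 0\<close> by simp
  finally have "?H * (1 + fps_X * ?r) = fps_X"
    by (simp only: fps_to_fls_eq_iff)
  hence "algebraic_fps (1 + fps_X * ?r)"
    using algebraic_fps_inv_quotient assms(2) G by simp
  thus ?thesis
    using algebraic_fps_affineD[of 1 "[:0, 1:]" ?r] by simp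
qed

subsection \<open>Asymptotic expansions along the negative imaginary axis\<close>

text \<open>The variable here is \<open>w = 1/z\<close>, so this filter describes \<open>z = \<i> y\<close> with \<open>y \<rightarrow> \<infinity>\<close>.\<close>

definition neg_imag_axis_at_0 :: "complex filter" where
  "neg_imag_axis_at_0 = filtermap (\<lambda>t. - (\<i> * complex_of_real t)) (at_right 0)"

lemma neg_imag_axis_at_0_neq_bot [simp]: "neg_imag_axis_at_0 \<noteq> bot"
  by (simp add: neg_imag_axis_at_0_def filtermap_bot_iff)

lemma neg_imag_axis_at_0_le: "neg_imag_axis_at_0 \<le> at 0"
proof -
  have "((\<lambda>t. - (\<i> * complex_of_real t)) \<longlongrightarrow> - (\<i> * complex_of_real 0)) (at_right 0)"
    by (intro tendsto_intros)
  moreover have "\<forall>\<^sub>F t in at_right 0. - (\<i> * complex_of_real t) \<noteq> 0"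
    by (rule eventually_at_right_less[THEN eventually_mono]) auto
  ultimately have "filterlim (\<lambda>t. - (\<i> * complex_of_real t)) (at 0) (at_right 0)"
    by (auto simp: filterlim_at)
  thus ?thesis
    by (simp add: neg_imag_axis_at_0_def filterlim_def)
qed

lemma eventually_neg_imag_axis_at_0:
  assumes "e > 0" "\<And>t. 0 < t \<Longrightarrow> t < e \<Longrightarrow> P (- (\<i> * complex_of_real t))"
  shows "eventually P neg_imag_axis_at_0"
  using assms unfolding neg_imag_axis_at_0_def eventually_filtermap eventually_at_right_field
  by auto

text \<open>Coefficients of \<open>p\<close> from \<open>N\<close> on are left free, so sums and
  products of approximating polynomials need no truncation.\<close>

definition has_asymp_expansion :: "(complex \<Rightarrow> complex) \<Rightarrow> real fps \<Rightarrow> bool" where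
  "has_asymp_expansion f a \<longleftrightarrow> (\<forall>N. \<exists>p. (\<forall>k<N. coeff p k = complex_of_real (a $ k)) \<and>
     (\<lambda>w. f w - poly p w) \<in> O[neg_imag_axis_at_0](\<lambda>w. w ^ N))"

lemma poly_tendsto_neg_imag_axis: "((\<lambda>w. poly p w) \<longlongrightarrow> poly p 0) neg_imag_axis_at_0"
  by (rule tendsto_mono[OF neg_imag_axis_at_0_le]) (intro tendsto_intros)

lemma poly_bigo_neg_imag_axis: "(\<lambda>w. poly p w) \<in> O[neg_imag_axis_at_0](\<lambda>_. 1)"
  by (rule bigoI_tendsto[where c = "poly p 0"]) (simp_all add: poly_tendsto_neg_imag_axis)

lemma has_asymp_expansion_bigo_1:
  assumes "has_asymp_expansion f a"
  shows "f \<in> O[neg_imag_axis_at_0](\<lambda>_. 1)"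
proof -
  obtain p where "(\<lambda>w. f w - poly p w) \<in> O[neg_imag_axis_at_0](\<lambda>w. w ^ 0)"
    using assms unfolding has_asymp_expansion_def by blast
  hence "(\<lambda>w. f w - poly p w) \<in> O[neg_imag_axis_at_0](\<lambda>_. 1)"
    by simp
  from sum_in_bigo(1)[OF this poly_bigo_neg_imag_axis[of p]] show ?thesis
    by simp
qed

lemma has_asymp_expansion_poly:
  "has_asymp_expansion (\<lambda>w. poly (map_poly complex_of_real p) w) (fps_of_poly p)"
  unfolding has_asymp_expansion_def
  by (intro allI exI[of _ "map_poly complex_of_real p"]) (simp add: coeff_map_poly)

lemma has_asymp_expansion_add:
  assumes "has_asymp_expansion f a" "has_asymp_expansion g b"
  shows "has_asymp_expansion (\<lambda>w. f w + g w) (a + b)"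
  unfolding has_asymp_expansion_def
proof
  fix N
  obtain p q where p: "\<forall>k<N. coeff p k = complex_of_real (a $ k)"
      "(\<lambda>w. f w - poly p w) \<in> O[neg_imag_axis_at_0](\<lambda>w. w ^ N)"
    and q: "\<forall>k<N. coeff q k = complex_of_real (b $ k)"
      "(\<lambda>w. g w - poly q w) \<in> O[neg_imag_axis_at_0](\<lambda>w. w ^ N)"
    using assms unfolding has_asymp_expansion_def by blast
  have "(\<lambda>w. (f w - poly p w) + (g w - poly q w)) \<in> O[neg_imag_axis_at_0](\<lambda>w. w ^ N)"
    using p(2) q(2) by (rule sum_in_bigo)
  thus "\<exists>p. (\<forall>k<N. coeff p k = complex_of_real ((a + b) $ k)) \<and>
      (\<lambda>w. f w + g w - poly p w) \<in> O[neg_imag_axis_at_0](\<lambda>w. w ^ N)"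
    using p(1) q(1) by (intro exI[of _ "p + q"]) (simp add: algebra_simps)
qed

lemma has_asymp_expansion_mult:
  assumes "has_asymp_expansion f a" "has_asymp_expansion g b"
  shows "has_asymp_expansion (\<lambda>w. f w * g w) (a * b)"
  unfolding has_asymp_expansion_def
proof
  fix N
  obtain p q where p: "\<forall>k<N. coeff p k = complex_of_real (a $ k)"
      "(\<lambda>w. f w - poly p w) \<in> O[neg_imag_axis_at_0](\<lambda>w. w ^ N)"
    and q: "\<forall>k<N. coeff q k = complex_of_real (b $ k)"
      "(\<lambda>w. g w - poly q w) \<in> O[neg_imag_axis_at_0](\<lambda>w. w ^ N)"
    using assms unfolding has_asymp_expansion_def by blast
  \<comment> \<open>Uses \<open>f g - p q = f (g - q) + q (f - p)\<close> with \<open>f\<close> and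
    \<open>q\<close> bounded.\<close>
  have "(\<lambda>w. f w * (g w - poly q w)) \<in> O[neg_imag_axis_at_0](\<lambda>w. 1 * w ^ N)"
    using has_asymp_expansion_bigo_1[OF assms(1)] q(2) by (rule landau_o.big.mult)
  moreover have "(\<lambda>w. poly q w * (f w - poly p w)) \<in> O[neg_imag_axis_at_0](\<lambda>w. 1 * w ^ N)"
    using poly_bigo_neg_imag_axis p(2) by (rule landau_o.big.mult)
  ultimately have "(\<lambda>w. f w * (g w - poly q w) + poly q w * (f w - poly p w))
      \<in> O[neg_imag_axis_at_0](\<lambda>w. 1 * w ^ N)"
    by (rule sum_in_bigo)
  moreover have "coeff (p * q) k = complex_of_real ((a * b) $ k)" if "k < N" for k
    using p(1) q(1) that by (auto simp: coeff_mult fps_mult_nth atMost_atLeast0 intro!: sum.cong)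
  ultimately show "\<exists>p. (\<forall>k<N. coeff p k = complex_of_real ((a * b) $ k)) \<and>
      (\<lambda>w. f w * g w - poly p w) \<in> O[neg_imag_axis_at_0](\<lambda>w. w ^ N)"
    by (intro exI[of _ "p * q"]) (simp add: algebra_simps)
qed

lemma has_asymp_expansion_power:
  assumes "has_asymp_expansion f a"
  shows "has_asymp_expansion (\<lambda>w. f w ^ n) (a ^ n)"
proof (induction n)
  case 0
  show ?case
    using has_asymp_expansion_poly[of 1] by simp
qed (use assms in \<open>simp add: has_asymp_expansion_mult\<close>)

lemma has_asymp_expansion_sum:
  assumes "\<And>i. i \<in> A \<Longrightarrow> has_asymp_expansion (f i) (a i)"
  shows "has_asymp_expansion (\<lambda>w. \<Sum>i\<in>A. f i w) (\<Sum>i\<in>A. a i)"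
  using assms
proof (induction A rule: infinite_finite_induct)
  case (insert i A)
  then show ?case
    by (simp add: has_asymp_expansion_add)
qed (use has_asymp_expansion_poly[of 0] in simp_all)

text \<open>If \<open>a\<close> had order \<open>n\<close>, then \<open>f w / w ^ n\<close> would
  tend to the nonzero \<open>a $ n\<close>, although \<open>f\<close> is eventually zero.\<close>

lemma has_asymp_expansion_eventually_0:
  assumes "has_asymp_expansion f a" "\<forall>\<^sub>F w in neg_imag_axis_at_0. f w = 0"
  shows "a = 0"
proof (rule ccontr)
  assume "a \<noteq> 0"
  define n where "n = subdegree a"
  \<comment> \<open>Precision \<open>Suc n\<close> fixes coefficient \<open>n\<close> of
    \<open>p\<close> and leaves an error that still vanishes after division by
    \<open>w ^ n\<close>.\<close>
  obtain p where p: "\<forall>k<Suc n. coeff p k = complex_of_real (a $ k)"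
      "(\<lambda>w. f w - poly p w) \<in> O[neg_imag_axis_at_0](\<lambda>w. w ^ Suc n)"
    using assms(1) unfolding has_asymp_expansion_def by blast
  define r where "r = poly_shift n p"
  have "p = monom 1 n * r"
  proof (rule poly_eqI)
    fix k
    have "coeff p k = 0" if "k < n"
    proof -
      have "a $ k = 0"
        using that unfolding n_def by (rule nth_less_subdegree_zero)
      thus ?thesis
        using p(1) that by simp
    qed
    thus "coeff p k = coeff (monom 1 n * r) k"
      by (simp add: r_def coeff_monom_mult coeff_poly_shift)
  qed
  hence r: "poly p w = w ^ n * poly r w" for w
    by (simp add: poly_monom)
  have nz: "\<forall>\<^sub>F w in neg_imag_axis_at_0. w \<noteq> 0"
    by (rule eventually_neg_imag_axis_at_0[of 1]) auto
  have "(\<lambda>w. f w - poly p w) \<in> o[neg_imag_axis_at_0](\<lambda>w. w ^ n)"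
  proof (rule landau_o.big_small_trans[OF p(2)])
    have "(\<lambda>w::complex. w) \<in> o[neg_imag_axis_at_0](\<lambda>_. 1)"
      using poly_tendsto_neg_imag_axis[of "[:0, 1:]"] by (intro smalloI_tendsto) auto
    hence "(\<lambda>w::complex. w * w ^ n) \<in> o[neg_imag_axis_at_0](\<lambda>w. 1 * w ^ n)"
      by (intro landau_o.small_big_mult) auto
    thus "(\<lambda>w::complex. w ^ Suc n) \<in> o[neg_imag_axis_at_0](\<lambda>w. w ^ n)" by simp
  qed
  hence "((\<lambda>w. (f w - poly p w) / w ^ n) \<longlongrightarrow> 0) neg_imag_axis_at_0"
    by (rule smalloD_tendsto)
  moreover have "\<forall>\<^sub>F w in neg_imag_axis_at_0. (f w - poly p w) / w ^ n = - poly r w"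
    using assms(2) nz by eventually_elim (simp add: r)
  ultimately have "((\<lambda>w. - poly r w) \<longlongrightarrow> 0) neg_imag_axis_at_0"
    by (rule Lim_transform_eventually)
  moreover have "((\<lambda>w. - poly r w) \<longlongrightarrow> - poly r 0) neg_imag_axis_at_0"
    by (intro tendsto_minus poly_tendsto_neg_imag_axis)
  ultimately have "poly r 0 = 0"
    using tendsto_unique[OF neg_imag_axis_at_0_neq_bot] by fastforce
  hence "a $ n = 0"
    using p(1) by (simp add: poly_0_coeff_0 r_def coeff_poly_shift)
  thus False
    using \<open>a \<noteq> 0\<close> by (simp add: n_def)
qed

subsection \<open>The Stieltjes transform\<close>

text \<open>Finite geometric sum for \<open>- w / (1 - x w)\<close> with exact remainder; no
  convergence is assumed, since \<open>x\<close> will range over a possibly unbounded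
  support.\<close>

lemma resolvent_expansion:
  fixes x w :: "'a::field"
  assumes "w \<noteq> 0" "x \<noteq> 1 / w"
  shows "1 / (x - 1 / w) = (\<Sum>j<N. - (x ^ j) * w ^ Suc j) + w ^ N * (x ^ N / (x - 1 / w))"
proof (induction N)
  case (Suc N)
  have "w ^ N * (x ^ N / (x - 1 / w)) = - (x ^ N) * w ^ Suc N + w ^ Suc N * (x ^ Suc N / (x - 1 / w))"
    using assms by (simp add: field_simps)
  with Suc show ?case
    by simp
qed simp

text \<open>Integrate \<open>resolvent_expansion\<close> termwise. For \<open>w = - i t\<close> with
  \<open>0 < t < 1\<close>, the distance from \<open>x\<close> to \<open>1 / w\<close> is at least
  \<open>1 / t > 1\<close>, so the remainder is at most the \<open>N\<close>-th absolute moment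
  times \<open>norm (w ^ N)\<close>.\<close>

lemma stieltjes_transform_expansion:
  assumes "prob_dist_fun F" "all_moments_exist F"
  shows "has_asymp_expansion (\<lambda>w. stieltjes_transform F (1 / w)) (- cauchy_series F)"
  unfolding has_asymp_expansion_def
proof
  fix N
  let ?M = "interval_measure F"
  interpret real_distribution ?M
    by (rule real_distribution_prob_dist_fun[OF assms(1)])
  have int_pow: "integrable ?M (\<lambda>x. x ^ j)" for j
    using assms(2) by (simp add: all_moments_exist_def)
  have int_pow_complex: "integrable ?M (\<lambda>x. complex_of_real (x ^ j))" for j
    by (intro integrable_of_real int_pow)
  define p where "p = (\<Sum>j<N. monom (- complex_of_real (moment F j)) (Suc j))"
  define C where "C = (LINT x|?M. \<bar>x\<bar> ^ N)"
  have coeff_p: "coeff p k = complex_of_real ((- cauchy_series F) $ k)" if "k < N" for k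
    using that by (cases k) (auto simp: p_def coeff_sum cauchy_series_def moment_gf_def)
  have bound: "norm (stieltjes_transform F (1 / w) - poly p w) \<le> C * norm (w ^ N)"
    if t: "0 < t" "t < 1" "w = - (\<i> * complex_of_real t)" for t w
  proof -
    have w: "w \<noteq> 0" "1 / w = Complex 0 (1 / t)"
      using t by (auto simp: complex_eq_iff Re_divide Im_divide power2_eq_square)
    let ?h = "\<lambda>x. complex_of_real x ^ N / (complex_of_real x - 1 / w)"
    have h_le: "norm (?h x) \<le> \<bar>x\<bar> ^ N" for x
    proof -
      have "1 \<le> 1 / t" using t by simp
      also have "1 / t = \<bar>Im (complex_of_real x - 1 / w)\<bar>"
        using t(1) unfolding w(2) by simp
      also have "\<dots> \<le> norm (complex_of_real x - 1 / w)"
        by (rule abs_Im_le_cmod)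
      finally show ?thesis
        using mult_left_mono[of 1 "norm (complex_of_real x - 1 / w)" "\<bar>x\<bar> ^ N"]
        by (simp add: norm_divide norm_power divide_le_eq)
    qed
    have int_abs: "integrable ?M (\<lambda>x. \<bar>x\<bar> ^ N)"
      using integrable_abs[OF int_pow[of N]] by (simp add: power_abs)
    have int_h: "integrable ?M ?h"
      by (rule Bochner_Integration.integrable_bound[OF int_abs]) (use h_le in \<open>auto\<close>)
    have "complex_of_real x \<noteq> 1 / w" for x
      unfolding w(2) using t(1) by (simp add: complex_eq_iff)
    hence "1 / (complex_of_real x - 1 / w) =
        (\<Sum>j<N. - complex_of_real (x ^ j) * w ^ Suc j) + w ^ N * ?h x" for x
      using resolvent_expansion[of w "complex_of_real x" N] w(1) by simp
    hence "stieltjes_transform F (1 / w) =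
        (LINT x|?M. (\<Sum>j<N. - complex_of_real (x ^ j) * w ^ Suc j) + w ^ N * ?h x)"
      by (simp add: stieltjes_transform_def)
    also have "\<dots> = (\<Sum>j<N. LINT x|?M. - complex_of_real (x ^ j) * w ^ Suc j) +
        w ^ N * (LINT x|?M. ?h x)"
      using int_h int_pow_complex
      by (subst Bochner_Integration.integral_add)
        (auto simp del: of_real_power power_Suc times_divide_eq_right)
    also have "(\<Sum>j<N. LINT x|?M. - complex_of_real (x ^ j) * w ^ Suc j) = poly p w"
      by (simp add: p_def moment_def poly_sum poly_monom del: of_real_power power_Suc)
    finally have "norm (stieltjes_transform F (1 / w) - poly p w) =
        norm (LINT x|?M. ?h x) * norm (w ^ N)"
      by (simp add: norm_mult)
    also have "norm (LINT x|?M. ?h x) \<le> (LINT x|?M. norm (?h x))"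
      by (rule integral_norm_bound)
    also have "\<dots> \<le> C"
      unfolding C_def using int_h int_abs h_le by (intro integral_mono integrable_norm)
    finally show ?thesis
      by (simp add: mult_right_mono)
  qed
  have "(\<lambda>w. stieltjes_transform F (1 / w) - poly p w) \<in> O[neg_imag_axis_at_0](\<lambda>w. w ^ N)"
    by (rule bigoI[where c = C], rule eventually_neg_imag_axis_at_0[of 1]) (use bound in auto)
  thus "\<exists>p. (\<forall>k<N. coeff p k = complex_of_real ((- cauchy_series F) $ k)) \<and>
      (\<lambda>w. stieltjes_transform F (1 / w) - poly p w) \<in> O[neg_imag_axis_at_0](\<lambda>w. w ^ N)"
    using coeff_p by blast
qed

lemma algebraic_cauchy_series:
  assumes "prob_dist_fun F" "algebraic_dist_fun F" "all_moments_exist F"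
  shows "algebraic_fps (- cauchy_series F)"
proof -
  obtain L where L: "L \<noteq> 0"
    "\<And>z. Im z > 0 \<Longrightarrow> eval_bipoly L (stieltjes_transform F z) z = 0"
    using assms(2) unfolding algebraic_dist_fun_def by blast
  define d where "d = degree L"
  define D where "D = Max ((degree \<circ> coeff L) ` {..d})"
  have D: "degree (coeff L i) \<le> D" if "i \<le> d" for i
    unfolding D_def using that by (intro Max_ge) auto
  \<comment> \<open>This is \<open>w ^ D\<close> times \<open>coeff L i\<close> at
    \<open>1 / w\<close>: reflection supplies the power \<open>degree (coeff L i)\<close>, the
    monomial the rest.\<close>
  define Q where "Q i = monom 1 (D - degree (coeff L i)) * reflect_poly (coeff L i)" for i
  have Q: "poly (map_poly complex_of_real (Q i)) w =
      w ^ D * poly (map_poly complex_of_real (coeff L i)) (1 / w)" if "i \<le> d" "w \<noteq> 0" for i w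
  proof -
    let ?l = "map_poly complex_of_real (coeff L i)"
    have deg: "degree ?l = degree (coeff L i)"
      by (simp add: degree_map_poly)
    have "map_poly complex_of_real (Q i) = monom 1 (D - degree ?l) * reflect_poly ?l"
      unfolding deg by (intro poly_eqI)
        (simp add: Q_def coeff_map_poly coeff_monom_mult coeff_reflect_poly deg)
    hence "poly (map_poly complex_of_real (Q i)) w = w ^ (D - degree ?l) * w ^ degree ?l * poly ?l (1 / w)"
      using that by (simp add: poly_monom poly_reflect_poly_nz inverse_eq_divide)
    also have "w ^ (D - degree ?l) * w ^ degree ?l = w ^ D"
      using D[OF that(1)] by (simp add: deg flip: power_add)
    finally show ?thesis .
  qed
  \<comment> \<open>At a particular \<open>z\<close> the leading coefficient of \<open>L\<close> may
    vanish, hence the fixed upper limit \<open>d\<close>.\<close>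
  have eval: "eval_bipoly L m z = (\<Sum>i\<le>d. poly (map_poly complex_of_real (coeff L i)) z * m ^ i)"
    for m z
  proof -
    let ?L = "map_poly (\<lambda>p. poly (map_poly complex_of_real p) z) L"
    have "degree ?L \<le> d"
      by (simp add: d_def map_poly_degree_leq)
    hence "(\<Sum>i\<le>degree ?L. coeff ?L i * m ^ i) = (\<Sum>i\<le>d. coeff ?L i * m ^ i)"
      by (intro sum.mono_neutral_left) (auto intro!: coeff_eq_0)
    thus ?thesis
      by (simp add: eval_bipoly_def poly_altdef coeff_map_poly)
  qed
  have "(\<Sum>i\<le>d. fps_of_poly (Q i) * (- cauchy_series F) ^ i) = 0"
  proof (rule has_asymp_expansion_eventually_0)
    show "has_asymp_expansion
        (\<lambda>w. \<Sum>i\<le>d. poly (map_poly complex_of_real (Q i)) w * stieltjes_transform F (1 / w) ^ i)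
        (\<Sum>i\<le>d. fps_of_poly (Q i) * (- cauchy_series F) ^ i)"
      by (intro has_asymp_expansion_sum has_asymp_expansion_mult has_asymp_expansion_power
          has_asymp_expansion_poly stieltjes_transform_expansion assms)
    show "\<forall>\<^sub>F w in neg_imag_axis_at_0.
        (\<Sum>i\<le>d. poly (map_poly complex_of_real (Q i)) w * stieltjes_transform F (1 / w) ^ i) = 0"
    proof (rule eventually_neg_imag_axis_at_0[of 1])
      fix t :: real assume "0 < t"
      define w where "w = - (\<i> * complex_of_real t)"
      have w: "w \<noteq> 0" "Im (1 / w) > 0"
        using \<open>0 < t\<close> by (auto simp: w_def Im_divide power2_eq_square)
      have "(\<Sum>i\<le>d. poly (map_poly complex_of_real (Q i)) w * stieltjes_transform F (1 / w) ^ i) =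
          w ^ D * eval_bipoly L (stieltjes_transform F (1 / w)) (1 / w)"
        unfolding eval sum_distrib_left by (intro sum.cong) (simp_all add: Q w(1) mult.assoc)
      thus "(\<Sum>i\<le>d. poly (map_poly complex_of_real (Q i)) w * stieltjes_transform F (1 / w) ^ i) = 0"
        using L(2) w(2) by simp
    qed simp
  qed
  moreover have "Q d \<noteq> 0"
    using L(1) by (simp add: Q_def d_def monom_eq_0_iff)
  ultimately show ?thesis
    unfolding algebraic_fps_def by (intro exI[of _ d] exI[of _ Q]) auto
qed

theorem theorem8p6:
  fixes F :: "real \<Rightarrow> real"
  assumes "prob_dist_fun F"
    and "algebraic_dist_fun F"
    and "all_moments_exist F"
  shows "algebraic_fps (moment_gf F) \<and> algebraic_fps (free_cumulant_gf F) \<and>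
    D_finite (moment_gf F) \<and> D_finite (free_cumulant_gf F) \<and>
    P_recursive (moment F) \<and> P_recursive (\<lambda>j. free_cumulant F (Suc j))"
proof -
  have G: "algebraic_fps (- cauchy_series F)"
    using assms by (rule algebraic_cauchy_series)
  \<comment> \<open>Here \<open>- cauchy_series F\<close> is \<open>- X\<close> times
    \<open>moment_gf F\<close>, so the affine lemma with \<open>b = - X\<close> removes sign and
    factor together.\<close>
  have \<mu>: "algebraic_fps (moment_gf F)"
    using G algebraic_fps_affineD[of 0 "[:0, -1:]" "moment_gf F"]
    by (simp add: cauchy_series_def fps_of_poly_pCons fps_const_neg[symmetric])
  have "algebraic_fps (cauchy_series F)"
    using G algebraic_fps_affineD[of 0 "-1" "cauchy_series F"] by (simp add: fps_of_poly_uminus)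
  with assms(1) have r: "algebraic_fps (free_cumulant_gf F)"
    by (rule algebraic_free_cumulant_gf)
  have "fps_nth (moment_gf F) = moment F"
    by (simp add: moment_gf_def fun_eq_iff)
  hence "P_recursive (moment F)"
    using D_finite_imp_P_recursive[OF algebraic_fps_imp_D_finite[OF \<mu>]] by simp
  moreover have "P_recursive (\<lambda>j. free_cumulant F (Suc j))"
    using D_finite_imp_P_recursive[OF algebraic_fps_imp_D_finite[OF r]]
    by (simp add: free_cumulant_def)
  ultimately show ?thesis
    using \<mu> r algebraic_fps_imp_D_finite by blast
qed

end
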